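(* Let $G$ be a connected balanceable oriented hypergraph with bipartite representation graph $\Gamma$. Then $$fr(G)=\min_{T}|B_T|,$$ where $T$ ranges over the spanning trees of $\Gamma$ and $B_T$ is the balancing set obtained from Camion's Incidence Reorientation Algorithm with spanning tree $T$.
   Context: An oriented hypergraph is a quintuple $G=(V,E,I,\iota,\sigma)$ with finite sets of vertices $V$, edges $E$, incidences $I$, an incidence function $\iota:I\to V\times E$ (not necessarily injective), and an orientation $\sigma:I\to\{+1,-1\}$. The bipartite representation graph $\Gamma$ of $G$ has vertex set $V\cup E$ and edge set $I$ (parallel edges allowed); $G$ is connected if $\Gamma$ is. A circle of $G$ is a cycle of $\Gamma$; a circle with $n$ incidences $i_1,\dots,i_n$ has sign $(-1)^{\lfloor n/2\rfloor}\prod_{k=1}^n\sigma(i_k)$. $G$ is balanced if every circle is positive, and balanceable if some orientation of the same underlying structure $(V,E,I,\iota)$ is balanced. The frustration index $fr(G)$ is the minimum number of incidence reversals (negations of $\sigma(i)$) necessary to make $G$ balanced. Camion's Incidence Reorientation Algorithm: given $G$ and a spanning tree $T$ of $\Gamma$, keep the signs of $\sigma$ on the incidences in $T$; for each incidence $e\in\Gamma\setminus T$, assign $e$ the unique sign making the fundamental circle of $e$ with respect to $T$ positive. The output is the resulting oriented hypergraph (balanced if $G$ is balanceable) together with the set $B_T$ of incidences whose signs changed. *)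

theory Defs
  imports Main
begin

text \<open>
  Undirected multigraphs: an edge carries the set of its ends (a singleton for a loop), so
  parallel edges are allowed.
\<close>

record ('a, 'b) multigraph =
  mverts :: "'a set"
  medges :: "'b set"
  mends :: "'b \<Rightarrow> 'a set"

definition mg_adj :: "('a, 'b) multigraph \<Rightarrow> ('a \<times> 'a) set" where
  "mg_adj H = {(u, v). \<exists>e \<in> medges H. mends H e = {u, v}}"

definition mg_connected :: "('a, 'b) multigraph \<Rightarrow> bool" where
  "mg_connected H \<longleftrightarrow> mverts H \<noteq> {} \<and> (\<forall>u \<in> mverts H. \<forall>v \<in> mverts H. (u, v) \<in> (mg_adj H)\<^sup>*)"

text \<open>
  A cycle is identified with its set of edges. Length 2 (two parallel edges) is allowed, whereas
  traversing one edge back and forth is excluded by the distinctness of the edges.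
\<close>

definition mg_cycle :: "('a, 'b) multigraph \<Rightarrow> 'b set \<Rightarrow> bool" where
  "mg_cycle H C \<longleftrightarrow>
     (\<exists>vs es. es \<noteq> [] \<and> length vs = length es \<and> distinct vs \<and> distinct es \<and>
        set vs \<subseteq> mverts H \<and> set es \<subseteq> medges H \<and>
        (\<forall>k < length es. mends H (es ! k) = {vs ! k, vs ! (Suc k mod length es)}) \<and>
        C = set es)"

definition mg_tree :: "('a, 'b) multigraph \<Rightarrow> bool" where
  "mg_tree H \<longleftrightarrow> mg_connected H \<and> (\<nexists>C. mg_cycle H C)"

text \<open>A spanning tree is identified with its set of edges.\<close>

definition mg_spanning_tree :: "('a, 'b) multigraph \<Rightarrow> 'b set \<Rightarrow> bool" where
  "mg_spanning_tree H T \<longleftrightarrow> T \<subseteq> medges H \<and> mg_tree (H\<lparr>medges := T\<rparr>)"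

definition fundamental_cycle :: "('a, 'b) multigraph \<Rightarrow> 'b set \<Rightarrow> 'b \<Rightarrow> 'b set" where
  "fundamental_cycle H T e = (THE C. mg_cycle H C \<and> C \<subseteq> insert e T)"

record ('v, 'e, 'i) ohypergraph =
  hverts :: "'v set"
  hedges :: "'e set"
  incidences :: "'i set"
  inc_fun :: "'i \<Rightarrow> 'v \<times> 'e"
  orient :: "'i \<Rightarrow> int"

locale oriented_hypergraph =
  fixes G :: "('v, 'e, 'i) ohypergraph"
  assumes finite_hverts: "finite (hverts G)"
    and finite_hedges: "finite (hedges G)"
    and finite_incidences: "finite (incidences G)"
    and inc_fun_mem: "i \<in> incidences G \<Longrightarrow> inc_fun G i \<in> hverts G \<times> hedges G"
    and orient_mem: "i \<in> incidences G \<Longrightarrow> orient G i \<in> {1, -1}"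

text \<open>Values of \<open>inc_fun\<close> and \<open>orient\<close> outside \<open>incidences\<close> are irrelevant.\<close>

definition rep_graph :: "('v, 'e, 'i) ohypergraph \<Rightarrow> ('v + 'e, 'i) multigraph" where
  "rep_graph G = \<lparr>mverts = hverts G <+> hedges G, medges = incidences G,
     mends = (\<lambda>i. {Inl (fst (inc_fun G i)), Inr (snd (inc_fun G i))})\<rparr>"

definition oh_connected :: "('v, 'e, 'i) ohypergraph \<Rightarrow> bool" where
  "oh_connected G \<longleftrightarrow> mg_connected (rep_graph G)"

definition circle :: "('v, 'e, 'i) ohypergraph \<Rightarrow> 'i set \<Rightarrow> bool" where
  "circle G C \<longleftrightarrow> mg_cycle (rep_graph G) C"

definition circle_sign :: "('v, 'e, 'i) ohypergraph \<Rightarrow> 'i set \<Rightarrow> int" where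
  "circle_sign G C = (-1) ^ (card C div 2) * (\<Prod>i\<in>C. orient G i)"

definition balanced :: "('v, 'e, 'i) ohypergraph \<Rightarrow> bool" where
  "balanced G \<longleftrightarrow> (\<forall>C. circle G C \<longrightarrow> circle_sign G C = 1)"

definition balanceable :: "('v, 'e, 'i) ohypergraph \<Rightarrow> bool" where
  "balanceable G \<longleftrightarrow>
     (\<exists>\<tau>. (\<forall>i \<in> incidences G. \<tau> i \<in> {1, -1}) \<and> balanced (G\<lparr>orient := \<tau>\<rparr>))"

definition reverse_incidences :: "('v, 'e, 'i) ohypergraph \<Rightarrow> 'i set \<Rightarrow> ('v, 'e, 'i) ohypergraph" where
  "reverse_incidences G B = G\<lparr>orient := (\<lambda>i. if i \<in> B then - orient G i else orient G i)\<rparr>"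

text \<open>
  The minimum is over a finite set when \<open>incidences G\<close> is finite; it is only meaningful when that
  set is nonempty, i.e. for balanceable \<open>G\<close>.
\<close>

definition frustration_index :: "('v, 'e, 'i) ohypergraph \<Rightarrow> nat" where
  "frustration_index G =
     Min {card B | B. B \<subseteq> incidences G \<and> balanced (reverse_incidences G B)}"

text \<open>
  All incidences of the fundamental circle of \<open>i\<close> other than \<open>i\<close> itself lie in \<open>T\<close> and keep
  their sign, so its sign in the output is the one obtained by changing \<open>orient G\<close> at \<open>i\<close> only.
\<close>

definition camion_orient :: "('v, 'e, 'i) ohypergraph \<Rightarrow> 'i set \<Rightarrow> 'i \<Rightarrow> int" where
  "camion_orient G T i =
     (if i \<in> T then orient G i
      else (THE s. s \<in> {1, -1} \<and>
              circle_sign (G\<lparr>orient := (orient G)(i := s)\<rparr>) (fundamental_cycle (rep_graph G) T i) = 1))"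

definition camion_output :: "('v, 'e, 'i) ohypergraph \<Rightarrow> 'i set \<Rightarrow> ('v, 'e, 'i) ohypergraph" where
  "camion_output G T = G\<lparr>orient := camion_orient G T\<rparr>"

definition balancing_set :: "('v, 'e, 'i) ohypergraph \<Rightarrow> 'i set \<Rightarrow> 'i set" where
  "balancing_set G T = {i \<in> incidences G. orient (camion_output G T) i \<noteq> orient G i}"

end

theory Submission
  imports Defs
begin

text \<open>
  A cycle meets every cut in an even number of edges, so reversing all the incidences of a cut
  preserves balance. Two minimality arguments rest on this. First, starting from any balanced
  orientation and switching along the fundamental cuts of a spanning tree \<open>T\<close>, one reaches a
  balanced orientation agreeing with the given one on \<open>T\<close>; the fundamental circles force it to be
  Camion's output, so \<open>B\<^sub>T\<close> is a balancing set. Second, if \<open>B\<close> is a balancing set of minimum size,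
  then no nonempty cut is contained in \<open>B\<close>, since it could be removed from \<open>B\<close>. Hence the complement
  of \<open>B\<close> is connected and contains a spanning tree \<open>T\<close>, and uniqueness of Camion's output gives
  \<open>B\<^sub>T = B\<close>.
\<close>

section \<open>Cycles, cuts and spanning trees of multigraphs\<close>

definition wf_multigraph :: "('a, 'b) multigraph \<Rightarrow> bool" where
  "wf_multigraph H \<longleftrightarrow> (\<forall>e \<in> medges H. \<exists>u \<in> mverts H. \<exists>v \<in> mverts H. mends H e = {u, v})"

text \<open>Phrased through the set of ends, so that neither end has to be singled out and loops
  drop out by themselves.\<close>

definition cut :: "('a, 'b) multigraph \<Rightarrow> 'a set \<Rightarrow> 'b set" where
  "cut H X = {e \<in> medges H. mends H e \<inter> X \<noteq> {} \<and> \<not> mends H e \<subseteq> X}"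

lemma wf_multigraph_restrict:
  assumes "wf_multigraph H" and "S \<subseteq> medges H"
  shows "wf_multigraph (H\<lparr>medges := S\<rparr>)"
  using assms unfolding wf_multigraph_def by auto

lemma mg_cycle_restrict:
  assumes "S \<subseteq> medges H"
  shows "mg_cycle (H\<lparr>medges := S\<rparr>) C \<longleftrightarrow> mg_cycle H C \<and> C \<subseteq> S"
  using assms unfolding mg_cycle_def by simp blast

lemma cut_restrict:
  assumes "S \<subseteq> medges H"
  shows "cut (H\<lparr>medges := S\<rparr>) X = cut H X \<inter> S"
  using assms unfolding cut_def by auto

lemma mg_cycle_subset: "mg_cycle H C \<Longrightarrow> C \<subseteq> medges H"
  unfolding mg_cycle_def by auto

lemma mg_cycle_finite: "mg_cycle H C \<Longrightarrow> finite C"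
  unfolding mg_cycle_def by auto

lemma mg_cycle_nonempty: "mg_cycle H C \<Longrightarrow> C \<noteq> {}"
  unfolding mg_cycle_def by auto

section \<open>Parity of cycles against cuts\<close>

lemma bij_betw_Suc_mod: "bij_betw (\<lambda>k. Suc k mod n) {..<n} {..<n}"
proof (cases n)
  case (Suc m)
  have "inj_on (\<lambda>k. Suc k mod n) {..<n}"
    using Suc by (auto simp: inj_on_def mod_Suc split: if_splits)
  moreover have "(\<lambda>k. Suc k mod n) ` {..<n} \<subseteq> {..<n}"
    using Suc by auto
  ultimately show ?thesis
    by (simp add: bij_betw_def endo_inj_surj)
qed simp

text \<open>Mark each vertex with -1 inside \<open>X\<close> and 1 outside. An edge contributes the
  product of the marks of its two ends, and going around the cycle every mark is used twice. The
  product form is the one that enters circle signs.\<close>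

lemma cycle_cut_prod:
  assumes "mg_cycle H C"
  shows "(\<Prod>e\<in>C. if e \<in> cut H X then - 1 else 1 :: int) = 1"
proof -
  obtain vs es where len: "length vs = length es" and dist: "distinct es"
    and sub: "set es \<subseteq> medges H"
    and ends: "\<forall>k < length es. mends H (es ! k) = {vs ! k, vs ! (Suc k mod length es)}"
    and C: "C = set es"
    using assms unfolding mg_cycle_def by blast
  let ?n = "length es"
  define s where "s k = (if vs ! k \<in> X then - 1 else 1 :: int)" for k
  have "(\<Prod>e\<in>C. if e \<in> cut H X then - 1 else 1 :: int) =
      (\<Prod>k<?n. if es ! k \<in> cut H X then - 1 else 1)"
    unfolding C using bij_betw_nth[OF dist refl refl] by (rule prod.reindex_bij_betw[symmetric])
  also have "\<dots> = (\<Prod>k<?n. s k * s (Suc k mod ?n))"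
  proof (rule prod.cong[OF refl])
    fix k assume "k \<in> {..<?n}"
    then have "es ! k \<in> medges H" "mends H (es ! k) = {vs ! k, vs ! (Suc k mod ?n)}"
      using sub ends by auto
    then show "(if es ! k \<in> cut H X then - 1 else 1) = s k * s (Suc k mod ?n)"
      by (auto simp: cut_def s_def)
  qed
  also have "\<dots> = (\<Prod>k<?n. s k) * (\<Prod>k<?n. s (Suc k mod ?n))"
    by (rule prod.distrib)
  also have "(\<Prod>k<?n. s (Suc k mod ?n)) = (\<Prod>k<?n. s k)"
    by (rule prod.reindex_bij_betw[OF bij_betw_Suc_mod])
  also have "(\<Prod>k<?n. s k) * (\<Prod>k<?n. s k) = (\<Prod>k<?n. s k * s k)"
    by (rule prod.distrib[symmetric])
  also have "\<dots> = 1"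
    by (rule prod.neutral) (simp add: s_def)
  finally show ?thesis .
qed

lemma even_card_cycle_cut:
  assumes "mg_cycle H C"
  shows "even (card (C \<inter> cut H X))"
proof -
  have "(- 1 :: int) ^ card (C \<inter> cut H X) = 1"
    using cycle_cut_prod[OF assms, of X] mg_cycle_finite[OF assms]
    by (simp add: prod.If_cases Int_def)
  then show ?thesis
    by (metis minus_one_power_iff one_neq_neg_one)
qed

section \<open>Paths, reachability, separating cuts and spanning trees\<close>

lemma simple_path_exists:
  assumes "(u, v) \<in> (mg_adj H)\<^sup>*"
  shows "\<exists>vs es. length vs = Suc (length es) \<and> distinct vs \<and> vs ! 0 = u \<and>
    vs ! length es = v \<and> set es \<subseteq> medges H \<and>
    (\<forall>k < length es. mends H (es ! k) = {vs ! k, vs ! Suc k})"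
  using assms
proof (induction rule: converse_rtrancl_induct)
  case base
  show ?case by (rule exI[of _ "[v]"], rule exI[of _ "[]"]) simp
next
  case (step u w)
  obtain vs es where p: "length vs = Suc (length es)" "distinct vs" "vs ! 0 = w"
    "vs ! length es = v" "set es \<subseteq> medges H"
    "\<forall>k < length es. mends H (es ! k) = {vs ! k, vs ! Suc k}"
    using step.IH by blast
  obtain e where e: "e \<in> medges H" "mends H e = {u, w}"
    using step.hyps(1) unfolding mg_adj_def by auto
  show ?case
  proof (cases "u \<in> set vs")
    case True
    then obtain j where j: "j < length vs" "vs ! j = u"
      by (auto simp: in_set_conv_nth)
    \<comment> \<open>The path already visits \<open>u\<close>: the part from that visit on is
      simple and starts at \<open>u\<close>, so the new edge is discarded.\<close>
    show ?thesis
      by (rule exI[of _ "drop j vs"], rule exI[of _ "drop j es"])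
        (use p j set_drop_subset[of j es] in auto)
  next
    case False
    have "\<forall>k < length (e # es). mends H ((e # es) ! k) = {(u # vs) ! k, (u # vs) ! Suc k}"
      using p e by (auto simp: less_Suc_eq_0_disj)
    then show ?thesis
      by (intro exI[of _ "u # vs"] exI[of _ "e # es"]) (use p e False in auto)
  qed
qed

text \<open>The edge \<open>e\<close> closes a simple path inside \<open>S\<close> and cannot repeat
  one of its edges. A loop \<open>e\<close> closes the path of length 0.\<close>

lemma cycle_through_edge:
  assumes wf: "wf_multigraph H" and e: "e \<in> medges H" "mends H e = {u, v}" "e \<notin> S"
    and S: "S \<subseteq> medges H" and conn: "(u, v) \<in> (mg_adj (H\<lparr>medges := S\<rparr>))\<^sup>*"
  shows "\<exists>C. mg_cycle H C \<and> C \<subseteq> insert e S"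
proof -
  obtain vs es where len: "length vs = Suc (length es)" and dist: "distinct vs"
    and u: "vs ! 0 = u" and v: "vs ! length es = v" and es: "set es \<subseteq> S"
    and ends: "\<And>k. k < length es \<Longrightarrow> mends H (es ! k) = {vs ! k, vs ! Suc k}"
    using simple_path_exists[OF conn] by auto
  \<comment> \<open>Distinct vertices force distinct edges: \<open>vs ! j\<close> comes strictly
    before both ends of the later edge \<open>es ! k\<close>.\<close>
  have "es ! j \<noteq> es ! k" if "j < k" "k < length es" for j k
  proof
    assume "es ! j = es ! k"
    then have "vs ! j \<in> {vs ! k, vs ! Suc k}"
      using ends[of j] ends[of k] that by auto
    then show False
      using that len dist by (auto simp: nth_eq_iff_index_eq)
  qed
  then have dist_es: "distinct es"
    unfolding distinct_conv_nth by (metis nat_neq_iff)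
  let ?es = "es @ [e]"
  \<comment> \<open>The index wraps around only at the last position, where \<open>e\<close> leads
    from \<open>v\<close> back to \<open>u\<close>.\<close>
  have ends': "mends H (?es ! k) = {vs ! k, vs ! (Suc k mod length ?es)}"
    if "k < length ?es" for k
  proof (cases "k < length es")
    case True
    then show ?thesis using ends by (simp add: nth_append)
  next
    case False
    then have "k = length es" using that by simp
    then show ?thesis using e u v by auto
  qed
  have "vs ! k \<in> mverts H" if "k < length vs" for k
  proof -
    have "vs ! k \<in> mends H (?es ! k)" "?es ! k \<in> medges H"
      using that len ends' e es S nth_mem[of k ?es] by auto
    then show ?thesis using wf unfolding wf_multigraph_def by fastforce
  qed
  then have "set vs \<subseteq> mverts H"
    by (auto simp: in_set_conv_nth)
  then have "mg_cycle H (set ?es)"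
    unfolding mg_cycle_def using len dist dist_es es e S ends'
    by (intro exI[of _ vs] exI[of _ ?es]) auto
  then show ?thesis using es by auto
qed

text \<open>Sets of ends are unordered, so adjacency is symmetric, and an edge has either both ends
  reachable from \<open>u\<close> or neither.\<close>

lemma cut_reachable_empty: "wf_multigraph H \<Longrightarrow> cut H {w. (u, w) \<in> (mg_adj H)\<^sup>*} = {}"
proof -
  let ?X = "{w. (u, w) \<in> (mg_adj H)\<^sup>*}"
  assume wf: "wf_multigraph H"
  have False if "e \<in> cut H ?X" for e
  proof -
    have e: "e \<in> medges H" using that unfolding cut_def by simp
    obtain a b where ab: "mends H e = {a, b}"
      using wf e unfolding wf_multigraph_def by blast
    have "(a, b) \<in> mg_adj H" "(b, a) \<in> mg_adj H"
      using e ab unfolding mg_adj_def by auto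
    then have "a \<in> ?X \<longleftrightarrow> b \<in> ?X"
      by (auto intro: rtrancl_into_rtrancl)
    then show False using that ab unfolding cut_def by auto
  qed
  then show ?thesis by blast
qed

text \<open>This is the fundamental cut of \<open>f\<close>: \<open>X\<close> is what one end of
  \<open>f\<close> still reaches in the forest once \<open>f\<close> is deleted.\<close>

lemma forest_fundamental_cut:
  assumes wf: "wf_multigraph H" and T: "T \<subseteq> medges H"
    and acyclic: "\<nexists>C. mg_cycle H C \<and> C \<subseteq> T" and f: "f \<in> T"
  shows "\<exists>X. cut H X \<inter> T = {f}"
proof -
  obtain u v where uv: "mends H f = {u, v}"
    using wf T f unfolding wf_multigraph_def by blast
  let ?S = "T - {f}" and ?H = "H\<lparr>medges := T - {f}\<rparr>"
  let ?X = "{w. (u, w) \<in> (mg_adj ?H)\<^sup>*}"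
  \<comment> \<open>Otherwise \<open>f\<close> and a path in \<open>T - {f}\<close> would close a
    cycle inside \<open>T\<close>.\<close>
  have "v \<notin> ?X"
    using cycle_through_edge[OF wf _ uv, of ?S] acyclic T f by (auto simp: insert_absorb)
  then have "f \<in> cut H ?X"
    using T f uv unfolding cut_def by auto
  moreover have "cut H ?X \<inter> ?S = {}"
    using cut_reachable_empty[OF wf_multigraph_restrict[OF wf], of ?S u] cut_restrict[of ?S H] T
    by auto
  ultimately show ?thesis using f by blast
qed

text \<open>Take for \<open>X\<close> a component of the subgraph with edge set \<open>S\<close>. No
  edge of \<open>S\<close> leaves it, but some edge of the connected graph \<open>H\<close>
  must.\<close>

lemma disconnecting_cut:
  assumes wf: "wf_multigraph H" and conn: "mg_connected H" and S: "S \<subseteq> medges H"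
    and disc: "\<not> mg_connected (H\<lparr>medges := S\<rparr>)"
  shows "\<exists>X. cut H X \<noteq> {} \<and> cut H X \<inter> S = {}"
proof -
  obtain u v where uv: "u \<in> mverts H" "v \<in> mverts H"
    "(u, v) \<notin> (mg_adj (H\<lparr>medges := S\<rparr>))\<^sup>*"
    using conn disc unfolding mg_connected_def by auto
  let ?X = "{w. (u, w) \<in> (mg_adj (H\<lparr>medges := S\<rparr>))\<^sup>*}"
  have "cut H ?X \<inter> S = {}"
    using cut_reachable_empty[OF wf_multigraph_restrict[OF wf S]] cut_restrict[OF S] by auto
  moreover have "cut H ?X \<noteq> {}"
  proof
    assume empty: "cut H ?X = {}"
    have "(u, v) \<in> (mg_adj H)\<^sup>*"
      using conn uv unfolding mg_connected_def by blast
    \<comment> \<open>If no edge crossed the cut, membership in \<open>X\<close> would propagate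
      from \<open>u\<close> along a walk in \<open>H\<close> to \<open>v\<close>.\<close>
    then have "v \<in> ?X"
    proof (induction rule: rtrancl_induct)
      case (step a b)
      then obtain e where "e \<in> medges H" "mends H e = {a, b}"
        unfolding mg_adj_def by blast
      then show ?case using step.IH empty unfolding cut_def by blast
    qed simp
    then show False using uv by simp
  qed
  ultimately show ?thesis by blast
qed

text \<open>A connected spanning edge set of least size has no cycle: deleting an edge of a cycle
  would disconnect it, and the resulting cut would meet that cycle in exactly one edge, against
  parity.\<close>

lemma spanning_tree_exists:
  assumes wf: "wf_multigraph H" and fin: "finite (medges H)" and conn: "mg_connected H"
  shows "\<exists>T. mg_spanning_tree H T"
proof -
  define P where "P S \<longleftrightarrow> S \<subseteq> medges H \<and> mg_connected (H\<lparr>medges := S\<rparr>)" for S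
  have "P (medges H)" using conn unfolding P_def by simp
  then obtain T where T: "P T" and least: "\<And>S. P S \<Longrightarrow> card T \<le> card S"
    using ex_has_least_nat[of P _ card] by blast
  have sub: "T \<subseteq> medges H" and connT: "mg_connected (H\<lparr>medges := T\<rparr>)"
    using T unfolding P_def by auto
  have "\<not> mg_cycle (H\<lparr>medges := T\<rparr>) C" for C
  proof
    assume C: "mg_cycle (H\<lparr>medges := T\<rparr>) C"
    then obtain e where e: "e \<in> C" using mg_cycle_nonempty by blast
    have CT: "C \<subseteq> T" using mg_cycle_subset[OF C] by simp
    have "card (T - {e}) < card T"
      using e CT finite_subset[OF sub fin] by (intro card_Diff1_less) auto
    then have "\<not> P (T - {e})" using least not_le by blast
    then have "\<not> mg_connected (H\<lparr>medges := T\<rparr>\<lparr>medges := T - {e}\<rparr>)"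
      using sub unfolding P_def by auto
    then obtain X where X: "cut (H\<lparr>medges := T\<rparr>) X \<noteq> {}"
      "cut (H\<lparr>medges := T\<rparr>) X \<inter> (T - {e}) = {}"
      using disconnecting_cut[OF wf_multigraph_restrict[OF wf sub] connT, of "T - {e}"] by auto
    then have "C \<inter> cut (H\<lparr>medges := T\<rparr>) X = {e}"
      using e unfolding cut_def by auto
    then show False using even_card_cycle_cut[OF C, of X] by simp
  qed
  then show ?thesis
    using sub connT unfolding mg_spanning_tree_def mg_tree_def by blast
qed

section \<open>Fundamental cycles of a spanning tree\<close>

lemma mg_spanning_treeD:
  assumes "mg_spanning_tree H T"
  shows "T \<subseteq> medges H" and "mg_connected (H\<lparr>medges := T\<rparr>)"
    and "\<nexists>C. mg_cycle H C \<and> C \<subseteq> T"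
  using assms mg_cycle_restrict unfolding mg_spanning_tree_def mg_tree_def by blast+

text \<open>Makes the definite description in \<open>fundamental_cycle\<close> meaningful.
  Existence: \<open>T\<close> joins the ends of \<open>e\<close>. Uniqueness: the fundamental cuts
  of the tree edges determine which of them the cycle contains.\<close>

lemma fundamental_cycle:
  assumes wf: "wf_multigraph H" and T: "mg_spanning_tree H T" and e: "e \<in> medges H" "e \<notin> T"
  shows "mg_cycle H (fundamental_cycle H T e)" and "fundamental_cycle H T e \<subseteq> insert e T"
    and "e \<in> fundamental_cycle H T e"
proof -
  note T' = mg_spanning_treeD[OF T]
  have mem: "e \<in> C" if "mg_cycle H C" "C \<subseteq> insert e T" for C
    using T'(3) that by (metis subset_insert)
  \<comment> \<open>Within \<open>insert e T\<close> the cut contains at most \<open>f\<close> and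
    \<open>e\<close>, and \<open>e\<close> lies in \<open>C\<close>; parity excludes meeting just
    one of them. The right-hand side is independent of \<open>C\<close>.\<close>
  have char: "f \<in> C \<longleftrightarrow> e \<in> cut H X"
    if C: "mg_cycle H C" "C \<subseteq> insert e T" and f: "f \<in> T" and X: "cut H X \<inter> T = {f}" for C f X
  proof -
    have "C \<inter> cut H X = (if f \<in> C then {f} else {}) \<union> (if e \<in> cut H X then {e} else {})"
      using C X mem[OF C] by auto
    then show ?thesis
      using even_card_cycle_cut[OF C(1), of X] f e by (auto split: if_splits)
  qed
  have "\<exists>!C. mg_cycle H C \<and> C \<subseteq> insert e T"
  proof (rule ex_ex1I)
    obtain u v where uv: "mends H e = {u, v}" "u \<in> mverts H" "v \<in> mverts H"
      using wf e unfolding wf_multigraph_def by blast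
    then have "(u, v) \<in> (mg_adj (H\<lparr>medges := T\<rparr>))\<^sup>*"
      using T'(2) unfolding mg_connected_def by simp
    then show "\<exists>C. mg_cycle H C \<and> C \<subseteq> insert e T"
      using cycle_through_edge[OF wf e(1) uv(1) e(2) T'(1)] by blast
  next
    fix C D assume CD: "mg_cycle H C \<and> C \<subseteq> insert e T" "mg_cycle H D \<and> D \<subseteq> insert e T"
    have "f \<in> C \<longleftrightarrow> f \<in> D" if "f \<in> T" for f
      using forest_fundamental_cut[OF wf T'(1,3) that] char CD that by metis
    then show "C = D" using CD mem by blast
  qed
  then have "mg_cycle H (fundamental_cycle H T e) \<and> fundamental_cycle H T e \<subseteq> insert e T"
    unfolding fundamental_cycle_def by (rule theI')
  then show "mg_cycle H (fundamental_cycle H T e)" "fundamental_cycle H T e \<subseteq> insert e T"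
    "e \<in> fundamental_cycle H T e"
    using mem by auto
qed

section \<open>Balanced orientations\<close>

text \<open>The range condition is included because \<open>balanced\<close> constrains only products
  over circles.\<close>

definition balanced_orientation :: "('v, 'e, 'i) ohypergraph \<Rightarrow> ('i \<Rightarrow> int) \<Rightarrow> bool" where
  "balanced_orientation G \<rho> \<longleftrightarrow>
     (\<forall>i \<in> incidences G. \<rho> i \<in> {1, -1}) \<and> balanced (G\<lparr>orient := \<rho>\<rparr>)"

definition switch :: "'i set \<Rightarrow> ('i \<Rightarrow> int) \<Rightarrow> 'i \<Rightarrow> int" where
  "switch B \<rho> i = (if i \<in> B then - \<rho> i else \<rho> i)"

lemma reverse_incidences_eq: "reverse_incidences G B = G\<lparr>orient := switch B (orient G)\<rparr>"
  unfolding reverse_incidences_def switch_def by simp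

lemma rep_graph_orient [simp]: "rep_graph (G\<lparr>orient := \<rho>\<rparr>) = rep_graph G"
  unfolding rep_graph_def by simp

lemma medges_rep_graph [simp]: "medges (rep_graph G) = incidences G"
  unfolding rep_graph_def by simp

lemma wf_rep_graph:
  assumes "oriented_hypergraph G"
  shows "wf_multigraph (rep_graph G)"
proof -
  interpret oriented_hypergraph G by fact
  show ?thesis
    unfolding wf_multigraph_def rep_graph_def using inc_fun_mem
    by (auto simp: mem_Times_iff)
qed

lemma circle_sign_cong:
  assumes "\<And>i. i \<in> C \<Longrightarrow> \<rho> i = \<rho>' i"
  shows "circle_sign (G\<lparr>orient := \<rho>\<rparr>) C = circle_sign (G\<lparr>orient := \<rho>'\<rparr>) C"
  using assms unfolding circle_sign_def by (simp cong: prod.cong)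

lemma balanced_iff:
  "balanced (G\<lparr>orient := \<rho>\<rparr>) \<longleftrightarrow>
    (\<forall>C. mg_cycle (rep_graph G) C \<longrightarrow> circle_sign (G\<lparr>orient := \<rho>\<rparr>) C = 1)"
  unfolding balanced_def circle_def by simp

lemma balanced_orientation_cong:
  assumes "\<And>i. i \<in> incidences G \<Longrightarrow> \<rho> i = \<rho>' i"
  shows "balanced_orientation G \<rho> \<longleftrightarrow> balanced_orientation G \<rho>'"
proof -
  have "circle_sign (G\<lparr>orient := \<rho>\<rparr>) C = circle_sign (G\<lparr>orient := \<rho>'\<rparr>) C"
    if "mg_cycle (rep_graph G) C" for C
    using assms mg_cycle_subset[OF that] by (intro circle_sign_cong) auto
  then show ?thesis
    using assms unfolding balanced_orientation_def balanced_iff by auto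
qed

text \<open>Switching multiplies the product over a circle by its cut product, which is 1; the power
  of -1 depends only on the length of the circle.\<close>

lemma balanced_orientation_switch_cut:
  assumes "balanced_orientation G \<rho>"
  shows "balanced_orientation G (switch (cut (rep_graph G) X) \<rho>)"
proof -
  let ?K = "cut (rep_graph G) X"
  have "circle_sign (G\<lparr>orient := switch ?K \<rho>\<rparr>) C = circle_sign (G\<lparr>orient := \<rho>\<rparr>) C"
    if C: "mg_cycle (rep_graph G) C" for C
  proof -
    have "(\<Prod>i\<in>C. switch ?K \<rho> i) = (\<Prod>i\<in>C. (if i \<in> ?K then - 1 else 1) * \<rho> i)"
      by (rule prod.cong) (auto simp: switch_def)
    also have "\<dots> = (\<Prod>i\<in>C. \<rho> i)"
      by (simp add: prod.distrib cycle_cut_prod[OF C])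
    finally show ?thesis unfolding circle_sign_def by simp
  qed
  then show ?thesis
    using assms unfolding balanced_orientation_def balanced_iff
    by (auto simp: switch_def)
qed

text \<open>Off \<open>i\<close>, the fundamental circle of \<open>i\<close> lies in
  \<open>T\<close>, where \<open>\<rho>\<close> and \<open>orient G\<close> agree. Its positivity
  under \<open>\<rho>\<close> thus pins down the sign that the algorithm assigns to
  \<open>i\<close>.\<close>

lemma camion_orient_unique:
  assumes G: "oriented_hypergraph G" and T: "mg_spanning_tree (rep_graph G) T"
    and \<rho>: "balanced_orientation G \<rho>" and agree: "\<And>i. i \<in> T \<Longrightarrow> \<rho> i = orient G i"
    and i: "i \<in> incidences G"
  shows "camion_orient G T i = \<rho> i"
proof (cases "i \<in> T")
  case True
  then show ?thesis using agree unfolding camion_orient_def by simp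
next
  case False
  let ?C = "fundamental_cycle (rep_graph G) T i"
  note C = fundamental_cycle[OF wf_rep_graph[OF G] T _ False, simplified, OF i]
  let ?sign = "\<lambda>s. circle_sign (G\<lparr>orient := (orient G)(i := s)\<rparr>) ?C"
  have sign: "?sign (\<rho> i) = 1"
  proof -
    have "?sign (\<rho> i) = circle_sign (G\<lparr>orient := \<rho>\<rparr>) ?C"
      using C(2) agree by (intro circle_sign_cong) auto
    then show ?thesis
      using \<rho> C(1) unfolding balanced_orientation_def balanced_iff by simp
  qed
  \<comment> \<open>The incidence \<open>i\<close> contributes exactly one factor, so the circle is
    positive for only one of the two signs.\<close>
  have neg: "?sign (- s) = - ?sign s" for s
  proof -
    have fin: "finite ?C" using C(1) by (rule mg_cycle_finite)
    have "(\<Prod>j\<in>?C. ((orient G)(i := s)) j) = s * (\<Prod>j\<in>?C - {i}. orient G j)" for s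
      by (subst prod.remove[OF fin C(3)]) (auto intro: prod.cong)
    then show ?thesis unfolding circle_sign_def by simp
  qed
  have "(THE s. s \<in> {1, -1} \<and> ?sign s = 1) = \<rho> i"
  proof (rule the_equality)
    show "\<rho> i \<in> {1, -1} \<and> ?sign (\<rho> i) = 1"
      using sign \<rho> i unfolding balanced_orientation_def by blast
  next
    fix s :: int assume s: "s \<in> {1, -1} \<and> ?sign s = 1"
    have "s \<noteq> - \<rho> i"
    proof
      assume "s = - \<rho> i"
      then show False using s sign neg[of "\<rho> i"] by simp
    qed
    moreover have "\<rho> i \<in> {1, -1}" using \<rho> i unfolding balanced_orientation_def by blast
    ultimately show "s = \<rho> i" using s by auto
  qed
  then show ?thesis using False unfolding camion_orient_def by simp
qed

text \<open>Choose a balanced orientation with the fewest disagreements with \<open>orient G\<close>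
  on \<open>T\<close>. Switching the fundamental cut of a disagreeing \<open>f\<close> would correct
  \<open>f\<close> and change nothing else on \<open>T\<close>.\<close>

lemma balanced_orientation_extending_tree:
  assumes G: "oriented_hypergraph G" and bal: "balanceable G"
    and T: "mg_spanning_tree (rep_graph G) T"
  shows "\<exists>\<rho>. balanced_orientation G \<rho> \<and> (\<forall>i \<in> T. \<rho> i = orient G i)"
proof -
  interpret oriented_hypergraph G by fact
  note T' = mg_spanning_treeD[OF T]
  define D where "D \<rho> = {i \<in> T. \<rho> i \<noteq> orient G i}" for \<rho>
  have "\<exists>\<rho>. balanced_orientation G \<rho>"
    using bal unfolding balanceable_def balanced_orientation_def by blast
  then obtain \<rho> where \<rho>: "balanced_orientation G \<rho>"
    and least: "\<And>\<rho>'. balanced_orientation G \<rho>' \<Longrightarrow> card (D \<rho>) \<le> card (D \<rho>')"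
    using ex_has_least_nat[of "balanced_orientation G" _ "\<lambda>\<rho>. card (D \<rho>)"] by blast
  have "\<rho> f = orient G f" if f: "f \<in> T" for f
  proof (rule ccontr)
    assume ne: "\<rho> f \<noteq> orient G f"
    obtain X where X: "cut (rep_graph G) X \<inter> T = {f}"
      using forest_fundamental_cut[OF wf_rep_graph[OF G] T'(1,3) f] by blast
    let ?\<rho> = "switch (cut (rep_graph G) X) \<rho>"
    have fI: "f \<in> incidences G" using f T'(1) by auto
    then have "\<rho> f \<in> {1, -1}" "orient G f \<in> {1, -1}"
      using \<rho> orient_mem unfolding balanced_orientation_def by blast+
    then have "?\<rho> f = orient G f"
      using ne X unfolding switch_def by auto
    moreover have "?\<rho> i = \<rho> i" if "i \<in> T" "i \<noteq> f" for i
      using that X unfolding switch_def by auto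
    ultimately have "D ?\<rho> = D \<rho> - {f}"
      unfolding D_def by (auto, metis)
    moreover have "f \<in> D \<rho>"
      using f ne unfolding D_def by simp
    moreover have "finite (D \<rho>)"
      using finite_subset[OF _ finite_incidences] T'(1) unfolding D_def by auto
    ultimately have "card (D ?\<rho>) < card (D \<rho>)"
      by (simp add: card_Diff1_less del: card_Diff_insert)
    then show False
      using least[OF balanced_orientation_switch_cut[OF \<rho>, of X]] by simp
  qed
  then show ?thesis using \<rho> by blast
qed

section \<open>Balancing sets as sets of disagreement\<close>

lemma balancing_set_eq:
  assumes "oriented_hypergraph G" and "mg_spanning_tree (rep_graph G) T"
    and "balanced_orientation G \<rho>" and "\<And>i. i \<in> T \<Longrightarrow> \<rho> i = orient G i"
  shows "balancing_set G T = {i \<in> incidences G. \<rho> i \<noteq> orient G i}"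
  using camion_orient_unique[OF assms] unfolding balancing_set_def camion_output_def by auto

text \<open>Two distinct signs are opposite, so the reversal yields \<open>\<rho>\<close> on all
  incidences; elsewhere the values may differ without affecting balance.\<close>

lemma balanced_reverse_disagreement:
  assumes G: "oriented_hypergraph G" and \<rho>: "balanced_orientation G \<rho>"
  shows "balanced_orientation G (switch {i \<in> incidences G. \<rho> i \<noteq> orient G i} (orient G))"
proof -
  interpret oriented_hypergraph G by fact
  have "switch {i \<in> incidences G. \<rho> i \<noteq> orient G i} (orient G) i = \<rho> i"
    if i: "i \<in> incidences G" for i
  proof -
    have "\<rho> i \<in> {1, -1}" "orient G i \<in> {1, -1}"
      using i \<rho> orient_mem unfolding balanced_orientation_def by blast+
    then show ?thesis using i unfolding switch_def by auto
  qed
  then show ?thesis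
    using \<rho> balanced_orientation_cong by blast
qed

text \<open>On a tree avoiding \<open>B\<close> the reversed orientation keeps the original signs,
  which lets \<open>camion_orient_unique\<close> apply to it.\<close>

lemma spanning_tree_avoiding_minimum_balancing_set:
  assumes G: "oriented_hypergraph G" and conn: "oh_connected G"
    and sub: "B \<subseteq> incidences G" and bal: "balanced_orientation G (switch B (orient G))"
    and least: "\<And>B'. \<lbrakk>B' \<subseteq> incidences G; balanced_orientation G (switch B' (orient G))\<rbrakk>
      \<Longrightarrow> card B \<le> card B'"
  shows "\<exists>T. mg_spanning_tree (rep_graph G) T \<and> T \<inter> B = {}"
proof -
  interpret oriented_hypergraph G by fact
  let ?H = "rep_graph G" and ?S = "incidences G - B"
  have wf: "wf_multigraph ?H" using G by (rule wf_rep_graph)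
  have "mg_connected (?H\<lparr>medges := ?S\<rparr>)"
  proof (rule ccontr)
    assume "\<not> mg_connected (?H\<lparr>medges := ?S\<rparr>)"
    then obtain X where X: "cut ?H X \<noteq> {}" "cut ?H X \<inter> ?S = {}"
      using disconnecting_cut[OF wf, of ?S] conn unfolding oh_connected_def by auto
    then have cutB: "cut ?H X \<subseteq> B" unfolding cut_def by auto
    \<comment> \<open>Incidences of the cut all lie in \<open>B\<close>, so they are reversed twice
      and return to their original sign.\<close>
    have "switch (cut ?H X) (switch B (orient G)) = switch (B - cut ?H X) (orient G)"
      using cutB by (auto simp: switch_def fun_eq_iff)
    then have "balanced_orientation G (switch (B - cut ?H X) (orient G))"
      using balanced_orientation_switch_cut[OF bal, of X] by simp
    then have "card B \<le> card (B - cut ?H X)"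
      using sub by (intro least) auto
    moreover have "card (B - cut ?H X) < card B"
      using X(1) cutB finite_subset[OF sub finite_incidences] by (intro psubset_card_mono) auto
    ultimately show False by simp
  qed
  then obtain T where "mg_spanning_tree (?H\<lparr>medges := ?S\<rparr>) T"
    using spanning_tree_exists[OF wf_multigraph_restrict[OF wf]] finite_incidences by fastforce
  then have "mg_spanning_tree ?H T \<and> T \<inter> B = {}"
    unfolding mg_spanning_tree_def by auto
  then show ?thesis by blast
qed

theorem lemma3p1p6:
  fixes G :: "('v, 'e, 'i) ohypergraph"
  assumes "oriented_hypergraph G"
    and "oh_connected G"
    and "balanceable G"
  shows "frustration_index G =
    Min {card (balancing_set G T) | T. mg_spanning_tree (rep_graph G) T}"
proof -
  interpret oriented_hypergraph G by fact
  define P where "P B \<longleftrightarrow> B \<subseteq> incidences G \<and> balanced_orientation G (switch B (orient G))" for B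
  let ?trees = "{card (balancing_set G T) | T. mg_spanning_tree (rep_graph G) T}"
  \<comment> \<open>Reversal keeps signs in \<open>{1, -1}\<close>, so the range condition holds
    automatically.\<close>
  have P_iff: "P B \<longleftrightarrow> B \<subseteq> incidences G \<and> balanced (reverse_incidences G B)" for B
    using orient_mem unfolding P_def reverse_incidences_eq balanced_orientation_def switch_def by auto
  obtain \<tau> where "balanced_orientation G \<tau>"
    using assms(3) unfolding balanceable_def balanced_orientation_def by blast
  \<comment> \<open>Balanceability supplies a first balancing set, so both the least
    \<open>B\<close> and the minimum exist.\<close>
  then have "P {i \<in> incidences G. \<tau> i \<noteq> orient G i}"
    using balanced_reverse_disagreement[OF assms(1)] unfolding P_def by blast
  then obtain B where B: "P B" and least: "\<And>B'. P B' \<Longrightarrow> card B \<le> card B'"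
    using ex_has_least_nat[of P _ card] by blast
  have "frustration_index G = Min {card B | B. P B}"
    unfolding frustration_index_def P_iff ..
  also have "\<dots> = card B"
  proof (rule Min_eqI)
    show "finite {card B | B. P B}"
      by (rule finite_subset[of _ "card ` Pow (incidences G)"]) (auto simp: P_def finite_incidences)
  qed (use B least in auto)
  also have "\<dots> = Min ?trees"
  proof (rule Min_eqI[symmetric])
    show "finite ?trees"
      by (rule finite_subset[of _ "(\<lambda>T. card (balancing_set G T)) ` Pow (incidences G)"])
        (auto simp: finite_incidences dest: mg_spanning_treeD(1))
  next
    \<comment> \<open>Lower bound: every Camion set is itself a balancing set.\<close>
    fix n assume "n \<in> ?trees"
    then obtain T where T: "mg_spanning_tree (rep_graph G) T" and n: "n = card (balancing_set G T)"
      by blast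
    obtain \<rho> where \<rho>: "balanced_orientation G \<rho>" "\<And>i. i \<in> T \<Longrightarrow> \<rho> i = orient G i"
      using balanced_orientation_extending_tree[OF assms(1,3) T] by blast
    have "balancing_set G T = {i \<in> incidences G. \<rho> i \<noteq> orient G i}"
      using balancing_set_eq[OF assms(1) T] \<rho> by blast
    then have "P (balancing_set G T)"
      unfolding P_def using balanced_reverse_disagreement[OF assms(1) \<rho>(1)] by simp
    then show "card B \<le> n" unfolding n by (rule least)
  next
    \<comment> \<open>The bound is attained: for a tree avoiding \<open>B\<close>, Camion's set is
      \<open>B\<close> itself.\<close>
    obtain T where T: "mg_spanning_tree (rep_graph G) T" "T \<inter> B = {}"
      using spanning_tree_avoiding_minimum_balancing_set[OF assms(1,2), of B] B least unfolding P_def by blast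
    have "balancing_set G T = {i \<in> incidences G. switch B (orient G) i \<noteq> orient G i}"
      using T B unfolding P_def
      by (intro balancing_set_eq[OF assms(1)]) (simp, simp, auto simp: switch_def)
    also have "\<dots> = B"
    proof -
      \<comment> \<open>A reversed value differs from the original one because it is
        nonzero.\<close>
      have "orient G i \<noteq> 0" if "i \<in> incidences G" for i
        using orient_mem[OF that] by auto
      then show ?thesis using B unfolding P_def switch_def by auto
    qed
    finally show "card B \<in> ?trees" using T(1) by blast
  qed
  finally show ?thesis .
qed

end
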